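(* Let $q$ be a prime with $q\equiv 3 \pmod 4$. For every $E\subset \mathbb{F}_q^{2}\times\mathbb{F}_q^2=\mathbb{F}_q^4$ and every $a\in\mathbb{F}_q$ with $a\neq 0$, $$\sum_{m\in\mathbb{F}_q^2,\ \Vert m\Vert=a} \left|\widehat{E}(m,\vec{0})\right|^2 \le 3^{\frac12}\, q^{-6}\,|E|^{\frac32},$$ where $\vec 0$ is the zero vector of $\mathbb{F}_q^2$.
   Context: For $m=(m_1,m_2)\in\mathbb{F}_q^2$ write $\Vert m\Vert=m_1^2+m_2^2\in\mathbb{F}_q$. A set $E$ is identified with its indicator function. Let $\chi$ be a fixed nontrivial additive character of $\mathbb{F}_q$ (the principal additive character). For $E\subset\mathbb{F}_q^4$ and $(m',m'')\in\mathbb{F}_q^2\times\mathbb{F}_q^2$, the Fourier transform is $$\widehat{E}(m',m'')=q^{-4}\sum_{x',x''\in\mathbb{F}_q^2}\chi(-x'\cdot m'-x''\cdot m'')E(x',x''),$$ with $\cdot$ the standard dot product. *)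

theory Defs
  imports "HOL-Analysis.Analysis" "HOL-Number_Theory.Cong" "HOL-Computational_Algebra.Primes"
begin

text \<open>The field with \<open>q\<close> elements is a type \<open>'a :: {field, finite}\<close> with \<open>CARD('a) = q\<close>, and
  its fourth power is split as \<open>('a ^ 2) \<times> ('a ^ 2)\<close>.\<close>

definition norm_sq :: "'a::field ^ 2 \<Rightarrow> 'a" where
  "norm_sq m = (m $ 1)\<^sup>2 + (m $ 2)\<^sup>2"

definition additive_character :: "('a::{field, finite} \<Rightarrow> complex) \<Rightarrow> bool" where
  "additive_character \<psi> \<longleftrightarrow>
     (\<forall>x. cmod (\<psi> x) = 1) \<and> (\<forall>x y. \<psi> (x + y) = \<psi> x * \<psi> y)"

definition nontrivial_additive_character :: "('a::{field, finite} \<Rightarrow> complex) \<Rightarrow> bool" where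
  "nontrivial_additive_character \<psi> \<longleftrightarrow> additive_character \<psi> \<and> (\<exists>x. \<psi> x \<noteq> 1)"

definition fourier4 ::
  "('a::{field, finite} \<Rightarrow> complex) \<Rightarrow> (('a ^ 2) \<times> ('a ^ 2)) set \<Rightarrow> 'a ^ 2 \<Rightarrow> 'a ^ 2 \<Rightarrow> complex" where
  "fourier4 \<psi> E m' m'' =
     of_nat CARD('a) powi (-4) *
     (\<Sum>x'\<in>UNIV. \<Sum>x''\<in>UNIV.
        \<psi> (- scalar_product x' m' - scalar_product x'' m'') * indicator E (x', x''))"

end

theory Submission
  imports Defs
begin

text \<open>Let \<open>f x'\<close> be the number of \<open>x''\<close> with \<open>(x', x'') \<in> E\<close>, so that up to the factor \<open>q\<^sup>-\<^sup>4\<close> the numbers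
  to be bounded are values of the Fourier transform \<open>S\<close> of \<open>f\<close>. The \<open>L\<^sup>2 \<rightarrow> L\<^sup>4\<close> extension
  estimate for the circle holds with constant \<open>3 q\<^sup>2\<close>: since \<open>-1\<close> is not a square, \<open>\<parallel>c\<parallel> \<noteq> 0\<close> for
  \<open>c \<noteq> 0\<close>, and so \<open>c \<noteq> 0\<close> is a sum of two points of the circle in at most two ways, while \<open>c = 0\<close>
  contributes one further term by the Cauchy-Schwarz inequality. By duality the sum \<open>T\<close> of the \<open>\<bar>S m\<bar>\<^sup>2\<close>
  over the circle is the sum of \<open>f G\<close>, where \<open>G\<close> is the extension of \<open>S\<close>, and two applications of
  the Cauchy-Schwarz inequality with \<open>f \<le> q\<^sup>2\<close> give \<open>T\<^sup>4 \<le> 3 q\<^sup>4 \<bar>E\<bar>\<^sup>3 T\<^sup>2\<close>.\<close>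

section \<open>Finite fields of cardinality 3 modulo 4\<close>

text \<open>Translation by 1 permutes the field, so it preserves the sum of all elements while
  adding 1 for each of them.\<close>

lemma of_nat_CARD_eq_0: "of_nat CARD('a::{field, finite}) = (0 :: 'a)"
proof -
  have "(\<Sum>x\<in>(UNIV::'a set). x + 1) = (\<Sum>x\<in>UNIV. x)"
    by (rule sum.reindex_bij_witness[of _ "\<lambda>x. x - 1" "\<lambda>x. x + 1"]) auto
  then show ?thesis by (simp add: sum.distrib)
qed

lemma two_neq_0_if_odd_CARD:
  assumes "odd CARD('a::{field, finite})"
  shows "(2 :: 'a) \<noteq> 0"
proof
  assume 2: "(2 :: 'a) = 0"
  obtain k where "CARD('a) = 2 * k + 1" using assms by (auto elim: oddE)
  then have "of_nat CARD('a) = (2 * of_nat k + 1 :: 'a)" by simp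
  with 2 of_nat_CARD_eq_0[where 'a='a] show False by simp
qed

text \<open>Multiplication by \<open>x\<close> permutes the nonzero elements; comparing their
  products before and after leaves the power of \<open>x\<close>.\<close>

lemma power_CARD_minus_1_eq_1:
  fixes x :: "'a::{field, finite}"
  assumes "x \<noteq> 0"
  shows "x ^ (CARD('a) - 1) = 1"
proof -
  let ?U = "UNIV - {0::'a}"
  have "(\<Prod>y\<in>?U. x * y) = (\<Prod>y\<in>?U. y)"
    by (rule prod.reindex_bij_witness[of _ "\<lambda>y. y / x" "\<lambda>y. x * y"]) (use assms in auto)
  moreover have "(\<Prod>y\<in>?U. y) \<noteq> 0" by simp
  ultimately show ?thesis by (simp add: prod.distrib card_Diff_singleton)
qed

text \<open>If \<open>CARD('a) = 4 * k + 3\<close>, half of \<open>CARD('a) - 1\<close> is the odd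
  number \<open>2 * k + 1\<close>. A square root of -1 would thus have -1 as its power of exponent
  \<open>CARD('a) - 1\<close>, and 1 = -1 fails in odd characteristic.\<close>

lemma square_neq_minus_1:
  fixes x :: "'a::{field, finite}"
  assumes "[CARD('a) = 3] (mod 4)"
  shows "x\<^sup>2 \<noteq> -1"
proof
  assume x: "x\<^sup>2 = -1"
  from assms have "CARD('a) mod 4 = 3" by (simp add: cong_def)
  then obtain k where k: "CARD('a) = 4 * k + 3"
    by (metis mult_div_mod_eq)
  have "x \<noteq> 0" using x by auto
  then have "1 = x ^ (CARD('a) - 1)" by (rule power_CARD_minus_1_eq_1[symmetric])
  also have "\<dots> = (x\<^sup>2) ^ (2 * k + 1)"
    unfolding power_mult[symmetric] by (rule arg_cong[where f = "power x"]) (simp add: k)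
  also have "\<dots> = -1" by (simp add: x power_mult)
  finally have "(2 :: 'a) = 0" by (metis add.right_inverse one_add_one)
  moreover have "odd CARD('a)" by (simp add: k)
  ultimately show False using two_neq_0_if_odd_CARD by blast
qed

lemma norm_sq_eq_0_iff:
  fixes c :: "'a::{field, finite} ^ 2"
  assumes "[CARD('a) = 3] (mod 4)"
  shows "norm_sq c = 0 \<longleftrightarrow> c = 0"
proof
  assume c: "norm_sq c = 0"
  have "c $ 2 = 0"
  proof (rule ccontr)
    assume n: "c $ 2 \<noteq> 0"
    have "(c $ 1)\<^sup>2 = - (c $ 2)\<^sup>2" using c by (simp add: norm_sq_def eq_neg_iff_add_eq_0)
    then have "(c $ 1 / c $ 2)\<^sup>2 = -1" using n by (simp add: power_divide)
    then show False using square_neq_minus_1[OF assms] by blast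
  qed
  with c show "c = 0" by (simp add: norm_sq_def vec_eq_iff forall_2)
qed (simp add: norm_sq_def)

text \<open>The vectors \<open>n - m\<close> and \<open>n - (c - m)\<close> are both orthogonal to
  \<open>c\<close>, hence both multiples of \<open>c\<close> turned by a right angle. They are also
  orthogonal to each other, and that direction is not isotropic because \<open>norm_sq c\<close> is
  nonzero; so one of them vanishes.\<close>

lemma circle_sum_representation_unique:
  fixes c m n :: "'a::{field, finite} ^ 2"
  assumes q: "[CARD('a) = 3] (mod 4)" and "c \<noteq> 0"
    and m: "norm_sq m = a" "norm_sq (c - m) = a"
    and n: "norm_sq n = a" "norm_sq (c - n) = a"
  shows "n = m \<or> n = c - m"
proof -
  define c1 c2 m1 m2 n1 n2
    where coords: "c1 = c $ 1" "c2 = c $ 2" "m1 = m $ 1" "m2 = m $ 2" "n1 = n $ 1" "n2 = n $ 2"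
  define u1 u2 where u: "u1 = n1 - m1" "u2 = n2 - m2"
  define v1 v2 where v: "v1 = n1 + m1 - c1" "v2 = n2 + m2 - c2"
  have N: "c1\<^sup>2 + c2\<^sup>2 \<noteq> 0"
    using norm_sq_eq_0_iff[OF q, of c] \<open>c \<noteq> 0\<close> by (simp add: norm_sq_def coords)
  have "odd CARD('a)" using q by (auto simp: cong_def) presburger
  then have two: "(2::'a) \<noteq> 0" by (rule two_neq_0_if_odd_CARD)
  have E: "m1\<^sup>2 + m2\<^sup>2 = a" "(c1 - m1)\<^sup>2 + (c2 - m2)\<^sup>2 = a"
    "n1\<^sup>2 + n2\<^sup>2 = a" "(c1 - n1)\<^sup>2 + (c2 - n2)\<^sup>2 = a"
    using m n by (simp_all add: norm_sq_def coords)
  have mc: "2 * (m1 * c1 + m2 * c2) = c1\<^sup>2 + c2\<^sup>2"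
  proof -
    have "2 * (m1 * c1 + m2 * c2)
        = c1\<^sup>2 + c2\<^sup>2 + (m1\<^sup>2 + m2\<^sup>2) - ((c1 - m1)\<^sup>2 + (c2 - m2)\<^sup>2)"
      by (simp add: power2_eq_square algebra_simps)
    then show ?thesis using E by simp
  qed
  have nc: "2 * (n1 * c1 + n2 * c2) = c1\<^sup>2 + c2\<^sup>2"
  proof -
    have "2 * (n1 * c1 + n2 * c2)
        = c1\<^sup>2 + c2\<^sup>2 + (n1\<^sup>2 + n2\<^sup>2) - ((c1 - n1)\<^sup>2 + (c2 - n2)\<^sup>2)"
      by (simp add: power2_eq_square algebra_simps)
    then show ?thesis using E by simp
  qed
  have "2 * (u1 * c1 + u2 * c2) = 2 * (n1 * c1 + n2 * c2) - 2 * (m1 * c1 + m2 * c2)"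
    by (simp add: u algebra_simps)
  also have "\<dots> = 0" unfolding mc nc by simp
  finally have uc: "u1 * c1 + u2 * c2 = 0" using two by (metis mult_eq_0_iff)
  have "2 * (v1 * c1 + v2 * c2)
      = 2 * (n1 * c1 + n2 * c2) + 2 * (m1 * c1 + m2 * c2) - 2 * (c1\<^sup>2 + c2\<^sup>2)"
    by (simp add: v power2_eq_square algebra_simps)
  also have "\<dots> = 0" unfolding mc nc by simp
  finally have vc: "v1 * c1 + v2 * c2 = 0" using two by (metis mult_eq_0_iff)
  have "u1 * v1 + u2 * v2 = (n1\<^sup>2 + n2\<^sup>2) - (m1\<^sup>2 + m2\<^sup>2) - (u1 * c1 + u2 * c2)"
    by (simp add: u v power2_eq_square algebra_simps)
  then have uv: "u1 * v1 + u2 * v2 = 0" by (simp add: E uc)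
  \<comment> \<open>As \<open>u\<close> and \<open>v\<close> are multiples of
    \<open>(- c2, c1)\<close>, each product of their coordinates, scaled by the norm of
    \<open>c\<close>, is a multiple of the scalar product of \<open>u\<close> and \<open>v\<close>.
    All four products together force one vector to vanish.\<close>
  have "(c1\<^sup>2 + c2\<^sup>2) * (u1 * v1) = 0" "(c1\<^sup>2 + c2\<^sup>2) * (u2 * v2) = 0"
    "(c1\<^sup>2 + c2\<^sup>2) * (u1 * v2) = 0" "(c1\<^sup>2 + c2\<^sup>2) * (u2 * v1) = 0"
    using uc vc uv by algebra+
  then have "(u1 = 0 \<and> u2 = 0) \<or> (v1 = 0 \<and> v2 = 0)" using N by auto
  then show ?thesis
    by (auto simp: u v coords vec_eq_iff forall_2 eq_diff_eq)
qed

lemma card_circle_sum_representations_le_2: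
  fixes c :: "'a::{field, finite} ^ 2"
  assumes "[CARD('a) = 3] (mod 4)" and "c \<noteq> 0"
  shows "card {m. norm_sq m = a \<and> norm_sq (c - m) = a} \<le> 2"
proof (cases "{m. norm_sq m = a \<and> norm_sq (c - m) = a} = {}")
  case False
  then obtain m where "norm_sq m = a" "norm_sq (c - m) = a" by blast
  then have "{m. norm_sq m = a \<and> norm_sq (c - m) = a} \<subseteq> {m, c - m}"
    using circle_sum_representation_unique[OF assms] by blast
  then have "card {m. norm_sq m = a \<and> norm_sq (c - m) = a} \<le> card {m, c - m}"
    by (intro card_mono) auto
  also have "\<dots> \<le> 2" by (simp add: card_insert_if)
  finally show ?thesis .
next
  case True
  then show ?thesis by (simp only: card.empty)
qed

section \<open>Plancherel's identity\<close>

lemma additive_character_add: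
  "additive_character \<psi> \<Longrightarrow> \<psi> (x + y) = \<psi> x * \<psi> y"
  by (simp add: additive_character_def)

lemma additive_character_0:
  assumes "additive_character \<psi>"
  shows "\<psi> 0 = 1"
proof -
  have "\<psi> 0 \<noteq> 0" using assms by (metis additive_character_def norm_zero zero_neq_one)
  with additive_character_add[OF assms, of 0 0] show ?thesis by simp
qed

lemma additive_character_minus:
  assumes "additive_character \<psi>"
  shows "\<psi> (- x) = cnj (\<psi> x)"
proof -
  have 1: "\<psi> x * \<psi> (- x) = 1"
    using additive_character_add[OF assms, of x "- x"] additive_character_0[OF assms] by simp
  have 2: "\<psi> x * cnj (\<psi> x) = 1"
    using assms by (simp add: additive_character_def flip: complex_norm_square)
  from 1 have "\<psi> x \<noteq> 0" by auto
  with 1 2 show ?thesis by (metis mult_left_cancel)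
qed

lemma scalar_product_add_left:
  "scalar_product (x + y) z = scalar_product x z + scalar_product y (z :: 'a::comm_semiring_1 ^ 'n)"
  by (simp add: scalar_product_def distrib_right sum.distrib)

lemma scalar_product_add_right:
  "scalar_product x (y + z) = scalar_product x y + scalar_product x (z :: 'a::comm_semiring_1 ^ 'n)"
  by (simp add: scalar_product_def distrib_left sum.distrib)

lemma scalar_product_diff_right:
  "scalar_product x (y - z) = scalar_product x y - scalar_product x (z :: 'a::comm_ring_1 ^ 'n)"
  by (simp add: scalar_product_def right_diff_distrib sum_subtractf)

text \<open>Orthogonality of characters: for \<open>c \<noteq> 0\<close> some translation of
  \<open>x\<close> multiplies the sum by a value of \<open>\<psi>\<close> other than 1.\<close>

lemma sum_character_scalar_product:
  fixes c :: "'a::{field, finite} ^ 'n"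
  assumes "nontrivial_additive_character \<psi>"
  shows "(\<Sum>x\<in>UNIV. \<psi> (scalar_product x c)) = (if c = 0 then of_nat CARD('a ^ 'n) else 0)"
proof (cases "c = 0")
  case True
  then show ?thesis
    using assms by (simp add: scalar_product_def additive_character_0 nontrivial_additive_character_def)
next
  case False
  then obtain i where i: "c $ i \<noteq> 0" by (auto simp: vec_eq_iff)
  obtain t where t: "\<psi> t \<noteq> 1" and \<psi>: "additive_character \<psi>"
    using assms by (auto simp: nontrivial_additive_character_def)
  define x0 :: "'a ^ 'n" where "x0 = axis i (t / c $ i)"
  have "scalar_product x0 c = (\<Sum>j\<in>UNIV. if j = i then t else 0)"
    unfolding scalar_product_def x0_def axis_def by (rule sum.cong) (use i in auto)
  then have x0: "scalar_product x0 c = t" by simp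
  have "(\<Sum>x\<in>UNIV. \<psi> (scalar_product x c)) = (\<Sum>x\<in>UNIV. \<psi> (scalar_product (x + x0) c))"
    by (rule sum.reindex_bij_witness[of _ "\<lambda>x. x + x0" "\<lambda>x. x - x0"]) auto
  also have "\<dots> = (\<Sum>x\<in>UNIV. \<psi> (scalar_product x c)) * \<psi> t"
    by (simp add: scalar_product_add_left additive_character_add[OF \<psi>] x0 sum_distrib_right)
  finally show ?thesis using t False by simp
qed

text \<open>Expanding the square and summing over \<open>x\<close> first, orthogonality keeps only
  the diagonal. The transform carries no normalising factor, hence the number of points on the
  right.\<close>

lemma plancherel:
  fixes h :: "'a::{field, finite} ^ 'n \<Rightarrow> complex"
  assumes "nontrivial_additive_character \<psi>"
  shows "(\<Sum>x\<in>UNIV. (cmod (\<Sum>c\<in>UNIV. h c * \<psi> (scalar_product x c)))\<^sup>2)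
           = real CARD('a ^ 'n) * (\<Sum>c\<in>UNIV. (cmod (h c))\<^sup>2)"
proof -
  have \<psi>: "additive_character \<psi>" using assms by (simp add: nontrivial_additive_character_def)
  have \<psi>_diff: "\<psi> u * cnj (\<psi> v) = \<psi> (u - v)" for u v
    using additive_character_add[OF \<psi>, of u "- v"] by (simp add: additive_character_minus[OF \<psi>])
  have "complex_of_real (\<Sum>x\<in>UNIV. (cmod (\<Sum>c\<in>UNIV. h c * \<psi> (scalar_product x c)))\<^sup>2)
      = (\<Sum>x\<in>UNIV. (\<Sum>c\<in>UNIV. h c * \<psi> (scalar_product x c)) *
          cnj (\<Sum>d\<in>UNIV. h d * \<psi> (scalar_product x d)))"
    by (simp only: of_real_sum complex_norm_square)
  also have "\<dots> = (\<Sum>x\<in>UNIV. \<Sum>c\<in>UNIV. \<Sum>d\<in>UNIV. h c * cnj (h d) * \<psi> (scalar_product x (c - d)))"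
    unfolding cnj_sum sum_product scalar_product_diff_right \<psi>_diff[symmetric]
    by (simp add: mult_ac)
  also have "\<dots> = (\<Sum>c\<in>UNIV. \<Sum>d\<in>UNIV. h c * cnj (h d) * (\<Sum>x\<in>UNIV. \<psi> (scalar_product x (c - d))))"
    unfolding sum_distrib_left
    by (subst sum.swap) (intro sum.cong refl sum.swap)
  also have "\<dots> = (\<Sum>c\<in>UNIV. \<Sum>d\<in>UNIV. if d = c then h c * cnj (h c) * of_nat CARD('a ^ 'n) else 0)"
    unfolding sum_character_scalar_product[OF assms] by (intro sum.cong) auto
  also have "\<dots> = (\<Sum>c\<in>UNIV. h c * cnj (h c) * of_nat CARD('a ^ 'n))"
    by simp
  also have "\<dots> = complex_of_real (real CARD('a ^ 'n) * (\<Sum>c\<in>UNIV. (cmod (h c))\<^sup>2))"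
    by (simp add: sum_distrib_left mult_ac flip: complex_norm_square)
  finally show ?thesis by (simp only: of_real_eq_iff)
qed

section \<open>The extension estimate for the circle\<close>

lemma sum_convolution:
  fixes u v :: "'b::{finite, ab_group_add} \<Rightarrow> 'c::comm_semiring_0"
  shows "(\<Sum>c\<in>UNIV. \<Sum>m\<in>UNIV. u m * v (c - m)) = (\<Sum>m\<in>UNIV. u m) * (\<Sum>m\<in>UNIV. v m)"
proof -
  have "(\<Sum>c\<in>UNIV. v (c - m)) = (\<Sum>n\<in>UNIV. v n)" for m
    by (rule sum.reindex_bij_witness[of _ "\<lambda>n. n + m" "\<lambda>c. c - m"]) auto
  then show ?thesis
    by (subst sum.swap) (simp add: sum_distrib_right flip: sum_distrib_left)
qed

lemma circle_convolution_L2_le: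
  fixes g :: "'a::{field, finite} ^ 2 \<Rightarrow> complex"
  assumes q: "[CARD('a) = 3] (mod 4)"
    and supp: "\<And>m. norm_sq m \<noteq> a \<Longrightarrow> g m = 0"
  shows "(\<Sum>c\<in>UNIV. (cmod (\<Sum>m\<in>UNIV. g m * g (c - m)))\<^sup>2) \<le> 3 * (\<Sum>m\<in>UNIV. (cmod (g m))\<^sup>2)\<^sup>2"
proof -
  define T where "T = (\<Sum>m\<in>UNIV. (cmod (g m))\<^sup>2)"
  \<comment> \<open>At \<open>c = 0\<close> the number of representations has no uniform bound, so
    Cauchy-Schwarz is applied to \<open>g\<close> and its reflection instead.\<close>
  have zero: "(cmod (\<Sum>m\<in>UNIV. g m * g (0 - m)))\<^sup>2 \<le> T\<^sup>2"
  proof -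
    have "(cmod (\<Sum>m\<in>UNIV. g m * g (0 - m)))\<^sup>2 \<le> (\<Sum>m\<in>UNIV. cmod (g m) * cmod (g (- m)))\<^sup>2"
      by (intro power_mono order.trans[OF norm_sum]) (auto simp: norm_mult)
    also have "\<dots> \<le> T * (\<Sum>m\<in>UNIV. (cmod (g (- m)))\<^sup>2)"
      unfolding T_def by (rule Cauchy_Schwarz_ineq_sum)
    also have "(\<Sum>m\<in>UNIV. (cmod (g (- m)))\<^sup>2) = T"
      unfolding T_def by (rule sum.reindex_bij_witness[of _ uminus uminus]) auto
    finally show ?thesis by (simp add: power2_eq_square)
  qed
  have nonzero: "(cmod (\<Sum>m\<in>UNIV. g m * g (c - m)))\<^sup>2
      \<le> 2 * (\<Sum>m\<in>UNIV. (cmod (g m))\<^sup>2 * (cmod (g (c - m)))\<^sup>2)" if "c \<noteq> 0" for c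
  proof -
    define R where "R = {m. norm_sq m = a \<and> norm_sq (c - m) = a}"
    have "(\<Sum>m\<in>UNIV. g m * g (c - m)) = (\<Sum>m\<in>R. g m * g (c - m))"
      by (rule sum.mono_neutral_right) (use supp in \<open>auto simp: R_def\<close>)
    then have "(cmod (\<Sum>m\<in>UNIV. g m * g (c - m)))\<^sup>2 \<le> (\<Sum>m\<in>R. 1 * cmod (g m * g (c - m)))\<^sup>2"
      \<comment> \<open>The factor 1 prepares Cauchy-Schwarz, which then produces the cardinality of
        \<open>R\<close>, at most 2.\<close>
      by (simp add: power_mono norm_sum)
    also have "\<dots> \<le> (\<Sum>m\<in>R. 1\<^sup>2) * (\<Sum>m\<in>R. (cmod (g m * g (c - m)))\<^sup>2)"
      by (rule Cauchy_Schwarz_ineq_sum)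
    also have "\<dots> \<le> 2 * (\<Sum>m\<in>UNIV. (cmod (g m * g (c - m)))\<^sup>2)"
      using card_circle_sum_representations_le_2[OF q that, of a]
      by (intro mult_mono sum_mono2 sum_nonneg) (auto simp: R_def)
    finally show ?thesis by (simp add: norm_mult power_mult_distrib)
  qed
  \<comment> \<open>The second summand is nonnegative and is kept at \<open>c = 0\<close> too, so
    that its sum over all \<open>c\<close> factors as \<open>2 * T\<^sup>2\<close>.\<close>
  have "(\<Sum>c\<in>UNIV. (cmod (\<Sum>m\<in>UNIV. g m * g (c - m)))\<^sup>2)
      \<le> (\<Sum>c\<in>UNIV. (if c = 0 then T\<^sup>2 else 0)
            + 2 * (\<Sum>m\<in>UNIV. (cmod (g m))\<^sup>2 * (cmod (g (c - m)))\<^sup>2))"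
    by (rule sum_mono) (use zero nonzero in \<open>auto intro!: add_increasing2 sum_nonneg\<close>)
  also have "\<dots> = 3 * T\<^sup>2"
    using sum_convolution[of "\<lambda>m. (cmod (g m))\<^sup>2" "\<lambda>m. (cmod (g m))\<^sup>2"]
    by (simp add: sum.distrib T_def power2_eq_square[of "sum _ _"] flip: sum_distrib_left)
  finally show ?thesis unfolding T_def .
qed

text \<open>The fourth powers of \<open>\<bar>G\<bar>\<close> are the squares of
  \<open>\<bar>G\<^sup>2\<bar>\<close>, and \<open>G\<^sup>2\<close> is the transform of the
  convolution of \<open>g\<close> with itself. Plancherel's identity reduces the claim to the
  convolution estimate.\<close>

lemma circle_extension_L4_le:
  fixes g :: "'a::{field, finite} ^ 2 \<Rightarrow> complex"
  assumes q: "[CARD('a) = 3] (mod 4)" and \<psi>: "nontrivial_additive_character \<psi>"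
    and supp: "\<And>m. norm_sq m \<noteq> a \<Longrightarrow> g m = 0"
  shows "(\<Sum>x\<in>UNIV. (cmod (\<Sum>m\<in>UNIV. g m * \<psi> (scalar_product x m))) ^ 4)
           \<le> 3 * (real CARD('a))\<^sup>2 * (\<Sum>m\<in>UNIV. (cmod (g m))\<^sup>2)\<^sup>2"
proof -
  define G where "G x = (\<Sum>m\<in>UNIV. g m * \<psi> (scalar_product x m))" for x
  define h where "h c = (\<Sum>m\<in>UNIV. g m * g (c - m))" for c
  have add: "\<psi> (u + v) = \<psi> u * \<psi> v" for u v
    using \<psi> by (simp add: nontrivial_additive_character_def additive_character_add)
  have G2: "(G x)\<^sup>2 = (\<Sum>c\<in>UNIV. h c * \<psi> (scalar_product x c))" for x
  proof -
    have "(G x)\<^sup>2 = (\<Sum>c\<in>UNIV. \<Sum>m\<in>UNIV. (g m * \<psi> (scalar_product x m)) *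
        (g (c - m) * \<psi> (scalar_product x (c - m))))"
      by (simp add: sum_convolution[of "\<lambda>m. g m * \<psi> (scalar_product x m)"
            "\<lambda>m. g m * \<psi> (scalar_product x m)"] G_def power2_eq_square)
    also have "\<dots> = (\<Sum>c\<in>UNIV. \<Sum>m\<in>UNIV. g m * g (c - m) * \<psi> (scalar_product x (m + (c - m))))"
      unfolding scalar_product_add_right add by (simp add: mult_ac)
    also have "\<dots> = (\<Sum>c\<in>UNIV. h c * \<psi> (scalar_product x c))"
      by (simp add: h_def sum_distrib_right)
    finally show ?thesis .
  qed
  have "(\<Sum>x\<in>UNIV. cmod (G x) ^ 4) = (\<Sum>x\<in>UNIV. (cmod ((G x)\<^sup>2))\<^sup>2)"
    by (simp add: norm_power flip: power_mult)
  also have "\<dots> = real CARD('a ^ 2) * (\<Sum>c\<in>UNIV. (cmod (h c))\<^sup>2)"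
    unfolding G2 by (rule plancherel[OF \<psi>])
  also have "\<dots> \<le> real CARD('a ^ 2) * (3 * (\<Sum>m\<in>UNIV. (cmod (g m))\<^sup>2)\<^sup>2)"
    unfolding h_def by (intro mult_left_mono circle_convolution_L2_le[OF q supp]) auto
  finally show ?thesis by (simp add: G_def mult_ac)
qed

section \<open>The restriction estimate\<close>

lemma circle_restriction_L2_le:
  fixes f :: "'a::{field, finite} ^ 2 \<Rightarrow> real"
  assumes q: "[CARD('a) = 3] (mod 4)" and \<psi>: "nontrivial_additive_character \<psi>"
    and f: "\<And>x. 0 \<le> f x" "\<And>x. f x \<le> B"
  shows "(\<Sum>m | norm_sq m = a. (cmod (\<Sum>x\<in>UNIV. complex_of_real (f x) * \<psi> (- scalar_product x m)))\<^sup>2)\<^sup>2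
           \<le> 3 * (real CARD('a))\<^sup>2 * B * (\<Sum>x\<in>UNIV. f x) ^ 3"
proof -
  define S where "S m = (\<Sum>x\<in>UNIV. complex_of_real (f x) * \<psi> (- scalar_product x m))" for m
  define g where "g m = (if norm_sq m = a then S m else 0)" for m
  define G where "G x = (\<Sum>m\<in>UNIV. g m * \<psi> (scalar_product x m))" for x
  define T where "T = (\<Sum>m | norm_sq m = a. (cmod (S m))\<^sup>2)"
  define F where "F = (\<Sum>x\<in>UNIV. f x)"
  have \<psi>': "additive_character \<psi>" using \<psi> by (simp add: nontrivial_additive_character_def)
  have T_g: "T = (\<Sum>m\<in>UNIV. (cmod (g m))\<^sup>2)"
    unfolding T_def by (rule sum.mono_neutral_cong_left) (auto simp: g_def)
  have nn: "0 \<le> T" "0 \<le> F" "0 \<le> B"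
    using f order.trans[OF f] by (auto simp: T_def F_def intro!: sum_nonneg)
  \<comment> \<open>Duality: expanding \<open>cnj (S m)\<close> and exchanging the sums pairs
    \<open>f\<close> with the extension \<open>G\<close> of \<open>g\<close>.\<close>
  have "complex_of_real T = (\<Sum>m\<in>UNIV. g m * cnj (S m))"
    unfolding T_g of_real_sum complex_norm_square by (rule sum.cong) (auto simp: g_def)
  also have "\<dots> = (\<Sum>m\<in>UNIV. \<Sum>x\<in>UNIV. complex_of_real (f x) * (g m * \<psi> (scalar_product x m)))"
    by (simp add: S_def sum_distrib_left additive_character_minus[OF \<psi>'] mult_ac)
  also have "\<dots> = (\<Sum>x\<in>UNIV. complex_of_real (f x) * G x)"
    by (subst sum.swap) (simp add: G_def sum_distrib_left)
  finally have "T = cmod (\<Sum>x\<in>UNIV. complex_of_real (f x) * G x)"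
    using nn by (metis norm_of_real abs_of_nonneg)
  also have "\<dots> \<le> (\<Sum>x\<in>UNIV. f x * cmod (G x))"
    by (rule order.trans[OF norm_sum]) (simp add: norm_mult f)
  finally have "T\<^sup>2 \<le> (\<Sum>x\<in>UNIV. f x * cmod (G x))\<^sup>2"
    using nn(1) by (rule power_mono)
  \<comment> \<open>Splitting \<open>f\<close> evenly makes the first Cauchy-Schwarz factor the
    total mass \<open>F\<close>; the second factor pairs \<open>f\<close> with
    \<open>\<bar>G\<bar>\<^sup>2\<close>, ready for a second application.\<close>
  also have "\<dots> = (\<Sum>x\<in>UNIV. sqrt (f x) * (sqrt (f x) * cmod (G x)))\<^sup>2"
    using f by (simp flip: mult.assoc)
  also have "\<dots> \<le> (\<Sum>x\<in>UNIV. (sqrt (f x))\<^sup>2) * (\<Sum>x\<in>UNIV. (sqrt (f x) * cmod (G x))\<^sup>2)"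
    by (rule Cauchy_Schwarz_ineq_sum)
  also have "\<dots> = F * (\<Sum>x\<in>UNIV. f x * (cmod (G x))\<^sup>2)"
    using f by (simp add: F_def power_mult_distrib)
  finally have "(T\<^sup>2)\<^sup>2 \<le> (F * (\<Sum>x\<in>UNIV. f x * (cmod (G x))\<^sup>2))\<^sup>2"
    by (rule power_mono) simp
  also have "\<dots> = F\<^sup>2 * (\<Sum>x\<in>UNIV. f x * (cmod (G x))\<^sup>2)\<^sup>2"
    by (simp add: power_mult_distrib)
  also have "\<dots> \<le> F\<^sup>2 * ((\<Sum>x\<in>UNIV. (f x)\<^sup>2) * (\<Sum>x\<in>UNIV. ((cmod (G x))\<^sup>2)\<^sup>2))"
    by (intro mult_left_mono Cauchy_Schwarz_ineq_sum) simp
  also have "\<dots> \<le> F\<^sup>2 * ((B * F) * (3 * (real CARD('a))\<^sup>2 * T\<^sup>2))"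
  proof (intro mult_left_mono mult_mono)
    show "(\<Sum>x\<in>UNIV. (f x)\<^sup>2) \<le> B * F"
      unfolding F_def sum_distrib_left power2_eq_square
      by (intro sum_mono mult_right_mono f)
    have "(\<Sum>x\<in>UNIV. cmod (G x) ^ 4) \<le> 3 * (real CARD('a))\<^sup>2 * T\<^sup>2"
      unfolding T_g G_def by (rule circle_extension_L4_le[OF q \<psi>, of a]) (simp add: g_def)
    then show "(\<Sum>x\<in>UNIV. ((cmod (G x))\<^sup>2)\<^sup>2) \<le> 3 * (real CARD('a))\<^sup>2 * T\<^sup>2"
      by (simp flip: power_mult)
  qed (use nn in \<open>auto intro!: sum_nonneg\<close>)
  also have "\<dots> = (3 * (real CARD('a))\<^sup>2 * B * F ^ 3) * T\<^sup>2"
    by (simp add: power2_eq_square power3_eq_cube)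
  finally have main: "T\<^sup>2 * T\<^sup>2 \<le> (3 * (real CARD('a))\<^sup>2 * B * F ^ 3) * T\<^sup>2"
    by (simp add: power2_eq_square)
  \<comment> \<open>The extension estimate for \<open>g\<close> brought \<open>T\<^sup>2\<close>
    back on the right; it cancels unless \<open>T = 0\<close>.\<close>
  have "T\<^sup>2 \<le> 3 * (real CARD('a))\<^sup>2 * B * F ^ 3"
  proof (cases "T = 0")
    case True
    then show ?thesis using nn by simp
  next
    case False
    then show ?thesis using main by (intro mult_right_le_imp_le[of "T\<^sup>2" "T\<^sup>2"]) auto
  qed
  then show ?thesis unfolding T_def S_def F_def .
qed

section \<open>From functions on the plane to subsets of the four-dimensional space\<close>

theorem lemma3p2:
  fixes q :: nat
    and \<psi> :: "'a::{field, finite} \<Rightarrow> complex"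
    and E :: "(('a ^ 2) \<times> ('a ^ 2)) set"
    and a :: 'a
  assumes "prime q" and "[q = 3] (mod 4)" and "CARD('a) = q"
    and "nontrivial_additive_character \<psi>"
    and "a \<noteq> 0"
  shows "(\<Sum>m\<in>{m :: 'a ^ 2. norm_sq m = a}. (cmod (fourier4 \<psi> E m 0))\<^sup>2)
           \<le> 3 powr (1/2) * real q powi (-6) * real (card E) powr (3/2)"
proof -
  define f where "f x = (\<Sum>y\<in>UNIV. indicator E (x, y) :: real)" for x
  define S where "S m = (\<Sum>x\<in>UNIV. complex_of_real (f x) * \<psi> (- scalar_product x m))" for m
  define T where "T = (\<Sum>m | norm_sq m = a. (cmod (S m))\<^sup>2)"
  have q: "[CARD('a) = 3] (mod 4)" and q0: "real q > 0"
    using assms by (auto simp: prime_gt_0_nat)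
  have f_le: "f x \<le> (real q)\<^sup>2" for x
  proof -
    have "f x \<le> (\<Sum>y\<in>(UNIV :: ('a ^ 2) set). 1)"
      unfolding f_def by (intro sum_mono) (simp add: indicator_def)
    then show ?thesis using assms(3) by simp
  qed
  have "(\<Sum>x\<in>UNIV. f x) = (\<Sum>z\<in>UNIV. indicator E z)"
    unfolding f_def by (simp add: sum.cartesian_product)
  also have "\<dots> = real (card E)"
    by (simp add: indicator_def of_bool_def flip: sum.inter_filter)
  finally have sum_f: "(\<Sum>x\<in>UNIV. f x) = real (card E)" .
  \<comment> \<open>The bound \<open>B\<close> is \<open>q\<^sup>2\<close>, the number of points in
    a fibre over \<open>x\<close>.\<close>
  have "T\<^sup>2 \<le> 3 * (real q)\<^sup>2 * (real q)\<^sup>2 * real (card E) ^ 3"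
    using circle_restriction_L2_le[OF q assms(4), of f "(real q)\<^sup>2" a] f_le
    by (simp add: T_def S_def assms(3) sum_f) (simp add: f_def sum_nonneg)
  also have "\<dots> = (3 powr (1/2) * (real q)\<^sup>2 * real (card E) powr (3/2))\<^sup>2"
  proof -
    have "(real (card E) powr (3/2))\<^sup>2 = real (card E) ^ 3"
      by (cases "card E = 0") (simp_all add: powr_power powr_numeral)
    then show ?thesis
      by (simp add: power_mult_distrib powr_half_sqrt)
  qed
  finally have T: "T \<le> 3 powr (1/2) * (real q)\<^sup>2 * real (card E) powr (3/2)"
    by (rule power2_le_imp_le) simp
  \<comment> \<open>At second frequency zero the character does not depend on the second variable,
    so the inner sum only counts the fibre of \<open>E\<close>.\<close>
  have F: "fourier4 \<psi> E m 0 = of_real (real q powi (-4)) * S m" for m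
  proof -
    have "complex_of_real (indicator E z) = indicator E z" for z
      by (simp add: indicator_def)
    then show ?thesis
      by (simp add: fourier4_def S_def f_def assms(3) sum_distrib_right mult.commute
          scalar_product_def power_int_minus)
  qed
  have "(\<Sum>m\<in>{m :: 'a ^ 2. norm_sq m = a}. (cmod (fourier4 \<psi> E m 0))\<^sup>2) = real q powi (-8) * T"
  proof -
    have "(real q powi (-4))\<^sup>2 = real q powi (-8)"
      by (simp add: power_int_minus power_inverse flip: power_mult)
    then show ?thesis
      by (simp only: F T_def norm_mult norm_of_real power_mult_distrib power2_abs sum_distrib_left)
  qed
  also have "\<dots> \<le> real q powi (-8) * (3 powr (1/2) * (real q)\<^sup>2 * real (card E) powr (3/2))"
    using T by (intro mult_left_mono) auto
  also have "\<dots> = 3 powr (1/2) * real q powi (-6) * real (card E) powr (3/2)"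
  proof -
    have "real q powi (-8) * real q powi 2 = real q powi (-6)"
      using q0 by (subst power_int_add[symmetric]) auto
    then show ?thesis by (simp add: mult_ac)
  qed
  finally show ?thesis .
qed

end
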